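(* Let $N\ge 2$ be an integer. The Corner-Difference MILP (CD-MILP) and the exact-cover formulation have the same feasible set in the original placement variables $x$. That is, for a vector $x=(x_{i,j,h})_{(i,j,h)\in\mathcal P}$, there exist $d=(d_{p,q})_{1\le p,q\le N+1}$ and $c=(c_{u,v})_{0\le u,v\le N}$ such that $(x,d,c)$ is feasible for CD-MILP if and only if $x$ is feasible for the exact-cover formulation.
   Context: Let $N\ge 2$ be an integer. The set of placements is $\mathcal P=\{(i,j,h)\in\mathbb Z^3 : 1\le h\le N-1,\ 1\le i,j\le N-h+1\}$; the triple $(i,j,h)$ represents an $h\times h$ square with upper-left cell $(i,j)$ (row $i$, column $j$) inside the $N\times N$ grid of unit cells $(u,v)$, $1\le u,v\le N$. Exact-cover formulation: minimize $\sum_{(i,j,h)\in\mathcal P}x_{i,j,h}$ subject to $$\sum_{\substack{(i,j,h)\in\mathcal P:\\ i\le u\le i+h-1,\ j\le v\le j+h-1}}x_{i,j,h}=1\quad\text{for all }u,v\in\{1,\dots,N\},$$ and $x_{i,j,h}\in\{0,1\}$ for all $(i,j,h)\in\mathcal P$. Corner coefficients: for $(i,j,h)\in\mathcal P$ and $1\le p,q\le N+1$, let $\alpha^{p,q}_{i,j,h}=+1$ if $(p,q)=(i,j)$ or $(p,q)=(i+h,j+h)$; $\alpha^{p,q}_{i,j,h}=-1$ if $(p,q)=(i+h,j)$ or $(p,q)=(i,j+h)$; and $\alpha^{p,q}_{i,j,h}=0$ otherwise. CD-MILP, in the variables $x_{i,j,h}$ ($(i,j,h)\in\mathcal P$), $d_{p,q}$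 ($1\le p,q\le N+1$), $c_{u,v}$ ($0\le u,v\le N$): minimize $\sum_{(i,j,h)\in\mathcal P}x_{i,j,h}$ subject to - $d_{p,q}=\sum_{(i,j,h)\in\mathcal P}\alpha^{p,q}_{i,j,h}\,x_{i,j,h}$ for $1\le p,q\le N+1$; - $c_{u,v}=c_{u-1,v}+c_{u,v-1}-c_{u-1,v-1}+d_{u,v}$ for $1\le u,v\le N$; - $c_{0,v}=0$ for $0\le v\le N$; - $c_{u,0}=0$ for $1\le u\le N$; - $c_{u,v}=1$ for $1\le u,v\le N$; - $d_{p,q}\in\mathbb Z$ for $1\le p,q\le N+1$ and $c_{u,v}\in\mathbb Z$ for $0\le u,v\le N$; - $x_{i,j,h}\in\{0,1\}$ for $(i,j,h)\in\mathcal P$. *)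

theory Defs
  imports Complex_Main
begin

definition placements :: "int \<Rightarrow> (int \<times> int \<times> int) set" where
  "placements N = {(i, j, h). 1 \<le> h \<and> h \<le> N - 1 \<and>
     1 \<le> i \<and> i \<le> N - h + 1 \<and> 1 \<le> j \<and> j \<le> N - h + 1}"

lemma finite_placements: "finite (placements N)"
proof (rule finite_subset)
  show "placements N \<subseteq> {1..N} \<times> {1..N} \<times> {1..N}"
    by (auto simp: placements_def)
qed simp

(* A vector indexed by a finite set of indices is represented by a total function;
   the values outside of the index set are left unconstrained and never used. *)

definition exact_cover_feasible :: "int \<Rightarrow> (int \<times> int \<times> int \<Rightarrow> real) \<Rightarrow> bool" where
  "exact_cover_feasible N x \<longleftrightarrow>
     (\<forall>u\<in>{1..N}. \<forall>v\<in>{1..N}.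
        (\<Sum>(i, j, h) \<in> {(i, j, h). (i, j, h) \<in> placements N \<and>
            i \<le> u \<and> u \<le> i + h - 1 \<and> j \<le> v \<and> v \<le> j + h - 1}. x (i, j, h)) = 1) \<and>
     (\<forall>(i, j, h) \<in> placements N. x (i, j, h) \<in> {0, 1})"

(* For h >= 1 the four corners are distinct, so the order of the cases is irrelevant. *)

definition corner_coeff :: "int \<Rightarrow> int \<Rightarrow> int \<times> int \<times> int \<Rightarrow> real" where
  "corner_coeff p q = (\<lambda>(i, j, h).
     if (p, q) = (i, j) \<or> (p, q) = (i + h, j + h) then 1
     else if (p, q) = (i + h, j) \<or> (p, q) = (i, j + h) then - 1
     else 0)"

definition cd_milp_feasible ::
  "int \<Rightarrow> (int \<times> int \<times> int \<Rightarrow> real) \<Rightarrow> (int \<Rightarrow> int \<Rightarrow> real) \<Rightarrow> (int \<Rightarrow> int \<Rightarrow> real) \<Rightarrow> bool" where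
  "cd_milp_feasible N x d c \<longleftrightarrow>
     (\<forall>p\<in>{1..N+1}. \<forall>q\<in>{1..N+1}.
        d p q = (\<Sum>(i, j, h) \<in> placements N. corner_coeff p q (i, j, h) * x (i, j, h))) \<and>
     (\<forall>u\<in>{1..N}. \<forall>v\<in>{1..N}.
        c u v = c (u - 1) v + c u (v - 1) - c (u - 1) (v - 1) + d u v) \<and>
     (\<forall>v\<in>{0..N}. c 0 v = 0) \<and>
     (\<forall>u\<in>{1..N}. c u 0 = 0) \<and>
     (\<forall>u\<in>{1..N}. \<forall>v\<in>{1..N}. c u v = 1) \<and>
     (\<forall>p\<in>{1..N+1}. \<forall>q\<in>{1..N+1}. d p q \<in> \<int>) \<and>
     (\<forall>u\<in>{0..N}. \<forall>v\<in>{0..N}. c u v \<in> \<int>) \<and>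
     (\<forall>(i, j, h) \<in> placements N. x (i, j, h) \<in> {0, 1})"

end

theory Submission
  imports Defs
begin

text \<open>
  The corner coefficients of a square are the mixed second difference of its indicator function:
  in each coordinate the indicator of an interval jumps by \<open>+1\<close> at its first cell and by
  \<open>-1\<close> just behind its last cell, and the product of the two jumps is nonzero exactly at the
  four corners (\<open>corner_coeff_eq_mixed_difference\<close>). By linearity, the vector \<open>d\<close> built from
  \<open>x\<close> is the mixed difference of the coverage function, which counts with weights \<open>x\<close> the squares
  lying over a cell. The recurrence of the CD-MILP asks for \<open>c\<close> to have the mixed difference \<open>d\<close>,
  and together with zero values on row \<open>0\<close> and column \<open>0\<close> this determines \<open>c\<close> on the whole grid
  (\<open>zero_of_zero_mixed_difference\<close>). Squares start in row and column \<open>1\<close>, so the coverage function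
  has these boundary values too. Hence \<open>c\<close> must be the coverage function, and the requirement that
  \<open>c\<close> equals \<open>1\<close> on all cells is the exact-cover constraint. The integrality conditions hold
  automatically for a binary \<open>x\<close>.
\<close>

definition square_indicator :: "int \<Rightarrow> int \<Rightarrow> int \<times> int \<times> int \<Rightarrow> real" where
  "square_indicator u v = (\<lambda>(i, j, h).
     of_bool (u \<in> {i..i + h - 1}) * of_bool (v \<in> {j..j + h - 1}))"

definition coverage :: "int \<Rightarrow> (int \<times> int \<times> int \<Rightarrow> real) \<Rightarrow> int \<Rightarrow> int \<Rightarrow> real" where
  "coverage N x u v = (\<Sum>s\<in>placements N. square_indicator u v s * x s)"

definition mixed_difference :: "(int \<Rightarrow> int \<Rightarrow> real) \<Rightarrow> int \<Rightarrow> int \<Rightarrow> real" where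
  "mixed_difference f u v = f u v - f (u - 1) v - f u (v - 1) + f (u - 1) (v - 1)"

lemma interval_indicator_difference:
  fixes i h u :: int
  assumes "h \<ge> 1"
  shows "of_bool (u \<in> {i..i + h - 1}) - of_bool (u - 1 \<in> {i..i + h - 1}) =
           (of_bool (u = i) - of_bool (u = i + h) :: real)"
  using assms by auto

text \<open>
  The mixed difference of a product of two one-variable functions is the product of their
  differences; multiplying out the two pairs of jumps gives the four signed corners.
\<close>
lemma corner_coeff_eq_mixed_difference:
  assumes "h \<ge> 1"
  shows "corner_coeff u v (i, j, h) =
           mixed_difference (\<lambda>u v. square_indicator u v (i, j, h)) u v"
proof -
  let ?I = "\<lambda>u. of_bool (u \<in> {i..i + h - 1}) :: real"
  let ?J = "\<lambda>v. of_bool (v \<in> {j..j + h - 1}) :: real"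
  have "mixed_difference (\<lambda>u v. square_indicator u v (i, j, h)) u v =
          (?I u - ?I (u - 1)) * (?J v - ?J (v - 1))"
    unfolding mixed_difference_def square_indicator_def prod.case by (simp only: algebra_simps)
  also have "\<dots> = (of_bool (u = i) - of_bool (u = i + h)) *
                   (of_bool (v = j) - of_bool (v = j + h))"
    unfolding interval_indicator_difference[OF assms] ..
  also have "\<dots> = corner_coeff u v (i, j, h)"
    using assms by (auto simp: corner_coeff_def)
  finally show ?thesis ..
qed

lemma mixed_difference_coverage:
  "mixed_difference (coverage N x) u v =
     (\<Sum>(i, j, h)\<in>placements N. corner_coeff u v (i, j, h) * x (i, j, h))"
proof -
  have "mixed_difference (coverage N x) u v =
          (\<Sum>s\<in>placements N. mixed_difference (\<lambda>u v. square_indicator u v s) u v * x s)"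
    by (simp add: mixed_difference_def coverage_def sum_subtractf sum.distrib algebra_simps)
  also have "\<dots> = (\<Sum>(i, j, h)\<in>placements N. corner_coeff u v (i, j, h) * x (i, j, h))"
    by (rule sum.cong) (auto simp: placements_def corner_coeff_eq_mixed_difference)
  finally show ?thesis .
qed

lemma coverage_eq_sum_covering:
  "coverage N x u v = (\<Sum>(i, j, h) \<in> {(i, j, h). (i, j, h) \<in> placements N \<and>
            i \<le> u \<and> u \<le> i + h - 1 \<and> j \<le> v \<and> v \<le> j + h - 1}. x (i, j, h))"
  unfolding coverage_def
  by (rule sum.mono_neutral_cong_right)
    (auto simp: finite_placements square_indicator_def)

lemma coverage_boundary:
  assumes "u \<le> 0 \<or> v \<le> 0"
  shows "coverage N x u v = 0"
  unfolding coverage_def using assms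
  by (intro sum.neutral) (auto simp: square_indicator_def placements_def)

lemma coverage_Ints:
  assumes "\<And>s. s \<in> placements N \<Longrightarrow> x s \<in> \<int>"
  shows "coverage N x u v \<in> \<int>"
  unfolding coverage_def
  by (intro Ints_sum Ints_mult assms) (auto simp: square_indicator_def)

text \<open>
  A cell value is determined by its three neighbours above and to the left, so the zeros
  propagate from the boundary, row by row and inside each row from left to right.
\<close>
lemma zero_of_zero_mixed_difference:
  fixes N :: int
  assumes diff: "\<And>u v. u \<in> {1..N} \<Longrightarrow> v \<in> {1..N} \<Longrightarrow> mixed_difference e u v = 0"
    and row: "\<And>v. v \<in> {0..N} \<Longrightarrow> e 0 v = 0"
    and col: "\<And>u. u \<in> {0..N} \<Longrightarrow> e u 0 = 0"
    and uv: "u \<in> {0..N}" "v \<in> {0..N}"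
  shows "e u v = 0"
proof -
  have "0 \<le> u" using uv by simp
  then have "u \<le> N \<longrightarrow> (\<forall>v\<in>{0..N}. e u v = 0)"
  proof (induction u rule: int_ge_induct)
    case base
    then show ?case using row by blast
  next
    case (step u)
    show ?case
    proof (intro impI ballI)
      fix v assume u: "u + 1 \<le> N" and v: "v \<in> {0..N}"
      have previous_row: "e u w = 0" if "w \<in> {0..N}" for w
        using step u that by auto
      have "0 \<le> v" using v by simp
      then have "v \<le> N \<longrightarrow> e (u + 1) v = 0"
      proof (induction v rule: int_ge_induct)
        case base
        then show ?case using col[of "u + 1"] u step.hyps by simp
      next
        case (step v)
        then show ?case
          using diff[of "u + 1" "v + 1"] u \<open>0 \<le> u\<close> previous_row[of v] previous_row[of "v + 1"]
          by (auto simp: mixed_difference_def)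
      qed
      then show "e (u + 1) v = 0" using v by simp
    qed
  qed
  then show ?thesis using uv by simp
qed

lemma cd_milp_feasible_imp_coverage:
  assumes feas: "cd_milp_feasible N x d c" and uv: "u \<in> {0..N}" "v \<in> {0..N}"
  shows "c u v = coverage N x u v"
proof -
  let ?e = "\<lambda>u v. c u v - coverage N x u v"
  have "?e u v = 0"
  proof (rule zero_of_zero_mixed_difference[where N = N and e = ?e])
    fix u v assume *: "u \<in> {1..N}" "v \<in> {1..N}"
    then have d: "d u v = mixed_difference (coverage N x) u v"
      using feas by (simp add: cd_milp_feasible_def mixed_difference_coverage)
    have "c u v = c (u - 1) v + c u (v - 1) - c (u - 1) (v - 1) + d u v"
      using feas * unfolding cd_milp_feasible_def by blast
    then show "mixed_difference ?e u v = 0"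
      using d by (simp add: mixed_difference_def)
  next
    fix v assume "v \<in> {0..N}"
    then show "?e 0 v = 0"
      using feas by (simp add: cd_milp_feasible_def coverage_boundary)
  next
    fix u assume *: "u \<in> {0..N}"
    have "c u 0 = 0"
    proof (cases "u = 0")
      case True
      then show ?thesis using feas * by (simp add: cd_milp_feasible_def)
    next
      case False
      then show ?thesis using feas * by (simp add: cd_milp_feasible_def)
    qed
    then show "?e u 0 = 0" by (simp add: coverage_boundary)
  qed (use uv in auto)
  then show ?thesis by simp
qed

lemma exact_cover_imp_cd_milp_feasible:
  assumes "exact_cover_feasible N x"
  shows "cd_milp_feasible N x (mixed_difference (coverage N x)) (coverage N x)"
proof -
  have cover: "coverage N x u v = 1" if "u \<in> {1..N}" "v \<in> {1..N}" for u v
    using assms that unfolding exact_cover_feasible_def coverage_eq_sum_covering by blast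
  have bin: "\<forall>(i, j, h) \<in> placements N. x (i, j, h) \<in> {0, 1}"
    using assms unfolding exact_cover_feasible_def by blast
  have "x s \<in> \<int>" if "s \<in> placements N" for s
    using bin that by (cases s) auto
  then have int: "coverage N x u v \<in> \<int>" for u v
    by (rule coverage_Ints)
  then have diff_int: "mixed_difference (coverage N x) p q \<in> \<int>" for p q
    by (simp add: mixed_difference_def)
  have recurrence: "coverage N x u v = coverage N x (u - 1) v + coverage N x u (v - 1)
      - coverage N x (u - 1) (v - 1) + mixed_difference (coverage N x) u v" for u v
    by (simp add: mixed_difference_def)
  show ?thesis
    unfolding cd_milp_feasible_def
    by (intro conjI ballI bin recurrence mixed_difference_coverage cover int diff_int
        coverage_boundary) simp_all
qed

theorem proposition1:
  fixes N :: int and x :: "int \<times> int \<times> int \<Rightarrow> real"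
  assumes "N \<ge> 2"
  shows "(\<exists>d c. cd_milp_feasible N x d c) \<longleftrightarrow> exact_cover_feasible N x"
proof
  assume "\<exists>d c. cd_milp_feasible N x d c"
  then obtain d c where feas: "cd_milp_feasible N x d c" by blast
  have "coverage N x u v = 1" if "u \<in> {1..N}" "v \<in> {1..N}" for u v
  proof -
    have "c u v = 1"
      using feas that unfolding cd_milp_feasible_def by blast
    then show ?thesis
      using cd_milp_feasible_imp_coverage[OF feas, of u v] that by simp
  qed
  moreover have "\<forall>(i, j, h) \<in> placements N. x (i, j, h) \<in> {0, 1}"
    using feas unfolding cd_milp_feasible_def by blast
  ultimately show "exact_cover_feasible N x"
    unfolding exact_cover_feasible_def coverage_eq_sum_covering[symmetric] by blast
next
  assume "exact_cover_feasible N x"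
  then show "\<exists>d c. cd_milp_feasible N x d c"
    using exact_cover_imp_cd_milp_feasible by blast
qed

end
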